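(* Let $X$ be a vector space over a field $\mathbb{K}$, and let $Y_\rho$ be the modular space of a convex modular $\rho$ satisfying the $\Delta_2$-condition. Let $E$ be a non-empty subset of $X$ that is symmetric with respect to $0$ and satisfies $x+y,\ x-y\in E$ and $kx\in E$ for all $x,y\in E$ and all $k\in\mathbb{K}$. Let $\alpha:E^2\to[0,\infty)$ be a function such that $$\lim_{n\to\infty}\alpha(x,nx)=0\quad\text{and}\quad \lim_{n\to\infty}\alpha(nx,ny)=0\qquad\text{for all }x,y\in E .$$ Let $\varphi:E\to Y_\rho$ be a mapping satisfying $$\rho\big(\varphi(x+y)+\varphi(x-y)-2\varphi(x)-2\varphi(y)\big)\le\alpha(x,y)\qquad\text{for all }x,y\in E .$$ Then $\varphi$ is quadratic on $E$, that is, $\varphi(x+y)+\varphi(x-y)=2\varphi(x)+2\varphi(y)$ for all $x,y\in E$.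
   Context: Let $Y$ be a (real or complex) vector space. A convex modular on $Y$ is a functional $\rho:Y\to[0,\infty)$ such that for all $u,v\in Y$: (1) $\rho(u)=0$ if and only if $u=0$; (2) $\rho(cu)=\rho(u)$ for every scalar $c$ with $|c|=1$; (3) $\rho(su+tv)\le s\rho(u)+t\rho(v)$ whenever $s,t\ge0$ and $s+t=1$. The associated modular space is $Y_\rho=\{u\in Y:\rho(\lambda u)\to0\text{ as }\lambda\to0\}$. The modular satisfies the $\Delta_2$-condition if there exists $\tau>0$ such that $\rho(2u)\le\tau\rho(u)$ for all $u\in Y_\rho$. Limits in $n$ are over positive integers $n$. *)

theory Defs
  imports Complex_Main
begin

(* The scalar type is left generic so that real and complex spaces are treated
   at once: both types are instances of real_normed_field and, by the theorems
   of Gelfand--Mazur and Ostrowski, they are up to isomorphism the only ones. *)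
locale convex_modular = vector_space scale
  for scale :: "'f::real_normed_field \<Rightarrow> 'y::ab_group_add \<Rightarrow> 'y" +
  fixes \<rho> :: "'y \<Rightarrow> real"
  assumes nonneg: "0 \<le> \<rho> u"
    and eq_zero_iff: "\<rho> u = 0 \<longleftrightarrow> u = 0"
    and balanced: "norm c = 1 \<Longrightarrow> \<rho> (scale c u) = \<rho> u"
    and convex: "\<lbrakk>0 \<le> s; 0 \<le> t; s + t = 1\<rbrakk> \<Longrightarrow>
      \<rho> (scale (of_real s) u + scale (of_real t) v) \<le> s * \<rho> u + t * \<rho> v"

definition modular_space ::
    "('f::real_normed_field \<Rightarrow> 'y::ab_group_add \<Rightarrow> 'y) \<Rightarrow> ('y \<Rightarrow> real) \<Rightarrow> 'y set" where
  "modular_space scale \<rho> = {u. ((\<lambda>c. \<rho> (scale c u)) \<longlongrightarrow> 0) (at 0)}"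

definition delta2 ::
    "('f::real_normed_field \<Rightarrow> 'y::ab_group_add \<Rightarrow> 'y) \<Rightarrow> ('y \<Rightarrow> real) \<Rightarrow> bool" where
  "delta2 scale \<rho> \<longleftrightarrow> (\<exists>\<tau>>0. \<forall>u\<in>modular_space scale \<rho>. \<rho> (scale 2 u) \<le> \<tau> * \<rho> u)"

definition quadratic_on ::
    "('f::real_normed_field \<Rightarrow> 'y::ab_group_add \<Rightarrow> 'y) \<Rightarrow>
     'x::ab_group_add set \<Rightarrow> ('x \<Rightarrow> 'y) \<Rightarrow> bool" where
  "quadratic_on scale E \<phi> \<longleftrightarrow>
     (\<forall>x\<in>E. \<forall>y\<in>E. \<phi> (x + y) + \<phi> (x - y) = scale 2 (\<phi> x) + scale 2 (\<phi> y))"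

end

theory Submission
  imports Defs
begin

text \<open>
  Write \<open>D x y\<close> for the quadratic difference of \<open>\<phi>\<close>. By \<open>\<Delta>\<^sub>2\<close> and convexity, the sequences
  in the modular space that tend to \<open>0\<close> form an additive group. The first condition on \<open>\<alpha>\<close>,
  applied to \<open>D z ((n + 1) z)\<close>, together with asymptotic evenness says that the second difference
  of \<open>n \<mapsto> \<phi> (n z)\<close> tends to \<open>2 \<phi> z\<close>. Hence the second difference of
  \<open>n \<mapsto> D (n x) (n y)\<close> tends to \<open>2 D x y\<close>; but it also tends to \<open>0\<close>, by the second condition
  on \<open>\<alpha>\<close>. No division by integers of the field of \<open>X\<close> occurs, so its characteristic is
  irrelevant.
\<close>

context convex_modular
begin

lemma scale_two: "scale 2 u = u + u"
  using scale_left_distrib[of 1 1 u] by simp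

lemma modular_minus: "\<rho> (- u) = \<rho> u"
  using balanced[of "- 1" u] by simp

text \<open>The sum is the midpoint of the doubled vectors, so convexity with weights 1/2 applies;
  doubled arguments are exactly what \<open>delta2\<close> controls.\<close>

lemma modular_add_le: "\<rho> (u + v) \<le> (\<rho> (scale 2 u) + \<rho> (scale 2 v)) / 2"
  using convex[of "1/2" "1/2" "scale 2 u" "scale 2 v"] by simp

lemma modular_space_minus: "u \<in> modular_space scale \<rho> \<Longrightarrow> - u \<in> modular_space scale \<rho>"
  by (simp add: modular_space_def modular_minus)

lemma modular_space_add:
  assumes "u \<in> modular_space scale \<rho>" and "v \<in> modular_space scale \<rho>"
  shows "u + v \<in> modular_space scale \<rho>"
proof -
  \<comment> \<open>The filter \<open>at 0\<close> is punctured, so doubling must also keep nonzero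
    scalars nonzero.\<close>
  have dbl: "filterlim (\<lambda>c::'f. 2 * c) (at 0) (at 0)"
    by (auto simp: filterlim_at eventually_at_filter intro!: tendsto_eq_intros)
  have lim: "((\<lambda>c. \<rho> (scale (2 * c) w)) \<longlongrightarrow> 0) (at 0)" if "w \<in> modular_space scale \<rho>" for w
    using filterlim_compose[OF _ dbl] that by (auto simp: modular_space_def)
  have "((\<lambda>c. \<rho> (scale c (u + v))) \<longlongrightarrow> 0) (at 0)"
  proof (rule tendsto_sandwich[where f = "\<lambda>_. 0"])
    show "((\<lambda>c. (\<rho> (scale (2 * c) u) + \<rho> (scale (2 * c) v)) / 2) \<longlongrightarrow> 0) (at 0)"
      using tendsto_divide[OF tendsto_add[OF lim[OF assms(1)] lim[OF assms(2)]], of "\<lambda>_. 2" 2]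
      by simp
    show "\<forall>\<^sub>F c in at 0. \<rho> (scale c (u + v))
        \<le> (\<rho> (scale (2 * c) u) + \<rho> (scale (2 * c) v)) / 2"
      using modular_add_le[of "scale _ u" "scale _ v"]
      by (intro always_eventually) (simp add: scale_right_distrib)
  qed (auto simp: nonneg)
  then show ?thesis
    by (simp add: modular_space_def)
qed

lemma modular_space_diff:
  "\<lbrakk>u \<in> modular_space scale \<rho>; v \<in> modular_space scale \<rho>\<rbrakk> \<Longrightarrow> u - v \<in> modular_space scale \<rho>"
  using modular_space_add[OF _ modular_space_minus] by (metis diff_conv_add_uminus)

text \<open>Membership is demanded of every term because the doubling bound of \<open>delta2\<close>
  holds only inside the modular space.\<close>

definition null_seq :: "(nat \<Rightarrow> 'y) \<Rightarrow> bool" where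
  "null_seq u \<longleftrightarrow> (\<forall>n. u n \<in> modular_space scale \<rho>) \<and> (\<lambda>n. \<rho> (u n)) \<longlonglongrightarrow> 0"

lemma null_seqI:
  assumes "\<And>n. u n \<in> modular_space scale \<rho>" and "\<And>n. \<rho> (u n) \<le> a n" and "a \<longlonglongrightarrow> 0"
  shows "null_seq u"
  unfolding null_seq_def
  using assms tendsto_sandwich[of "\<lambda>_. 0" "\<lambda>n. \<rho> (u n)" sequentially a 0]
  by (auto simp: nonneg)

lemma null_seq_minus: "null_seq u \<Longrightarrow> null_seq (\<lambda>n. - u n)"
  by (simp add: null_seq_def modular_minus modular_space_minus)

text \<open>The midpoint bound costs a doubling of each summand, which \<open>delta2\<close> absorbs
  into the fixed factor \<tau>.\<close>

lemma null_seq_add: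
  assumes "delta2 scale \<rho>" and u: "null_seq u" and v: "null_seq v"
  shows "null_seq (\<lambda>n. u n + v n)"
proof -
  obtain \<tau> where \<tau>: "\<And>w. w \<in> modular_space scale \<rho> \<Longrightarrow> \<rho> (scale 2 w) \<le> \<tau> * \<rho> w"
    using assms(1) by (auto simp: delta2_def)
  show ?thesis
  proof (rule null_seqI)
    show "u n + v n \<in> modular_space scale \<rho>" for n
      using u v by (simp add: null_seq_def modular_space_add)
    show "\<rho> (u n + v n) \<le> (\<tau> * \<rho> (u n) + \<tau> * \<rho> (v n)) / 2" for n
      using modular_add_le[of "u n" "v n"] \<tau>[of "u n"] \<tau>[of "v n"] u v
      by (simp add: null_seq_def)
    show "(\<lambda>n. (\<tau> * \<rho> (u n) + \<tau> * \<rho> (v n)) / 2) \<longlonglongrightarrow> 0"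
      using u v by (auto simp: null_seq_def intro!: tendsto_eq_intros)
  qed
qed

lemma null_seq_diff:
  "\<lbrakk>delta2 scale \<rho>; null_seq u; null_seq v\<rbrakk> \<Longrightarrow> null_seq (\<lambda>n. u n - v n)"
  using null_seq_add[OF _ _ null_seq_minus] by fastforce

text \<open>Definiteness of \<rho> turns a limit back into an identity; exact equations are
  extracted from asymptotic ones this way.\<close>

lemma null_seq_const: "null_seq (\<lambda>_. w) \<longleftrightarrow> w = 0"
  by (auto simp: null_seq_def LIMSEQ_const_iff eq_zero_iff[THEN iffD2] eq_zero_iff modular_space_def)

lemma null_seq_offset: "null_seq u \<Longrightarrow> null_seq (\<lambda>n. u (n + k))"
  by (auto simp: null_seq_def intro: LIMSEQ_ignore_initial_segment)

lemma double_eq_zero: "(u :: 'y) + u = 0 \<Longrightarrow> u = 0"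
  using scale_two[of u] by simp

end

theorem theorem1:
  fixes scaleX :: "'k::field \<Rightarrow> 'x::ab_group_add \<Rightarrow> 'x"
    and scaleY :: "'f::real_normed_field \<Rightarrow> 'y::ab_group_add \<Rightarrow> 'y"
    and \<rho> :: "'y \<Rightarrow> real"
    and E :: "'x set"
    and \<alpha> :: "'x \<Rightarrow> 'x \<Rightarrow> real"
    and \<phi> :: "'x \<Rightarrow> 'y"
  assumes X: "vector_space scaleX"
    and modular: "convex_modular scaleY \<rho>"
    and delta2: "delta2 scaleY \<rho>"
    and E_nonempty: "E \<noteq> {}"
    and E_symmetric: "\<And>x. x \<in> E \<Longrightarrow> - x \<in> E"
    and E_add: "\<And>x y. \<lbrakk>x \<in> E; y \<in> E\<rbrakk> \<Longrightarrow> x + y \<in> E"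
    and E_diff: "\<And>x y. \<lbrakk>x \<in> E; y \<in> E\<rbrakk> \<Longrightarrow> x - y \<in> E"
    and E_scale: "\<And>k x. x \<in> E \<Longrightarrow> scaleX k x \<in> E"
    and \<alpha>_nonneg: "\<And>x y. \<lbrakk>x \<in> E; y \<in> E\<rbrakk> \<Longrightarrow> 0 \<le> \<alpha> x y"
    and \<alpha>_lim1: "\<And>x. x \<in> E \<Longrightarrow> (\<lambda>n. \<alpha> x (scaleX (of_nat n) x)) \<longlonglongrightarrow> 0"
    and \<alpha>_lim2: "\<And>x y. \<lbrakk>x \<in> E; y \<in> E\<rbrakk> \<Longrightarrow>
      (\<lambda>n. \<alpha> (scaleX (of_nat n) x) (scaleX (of_nat n) y)) \<longlonglongrightarrow> 0"
    and \<phi>_range: "\<And>x. x \<in> E \<Longrightarrow> \<phi> x \<in> modular_space scaleY \<rho>"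
    and \<phi>_approx: "\<And>x y. \<lbrakk>x \<in> E; y \<in> E\<rbrakk> \<Longrightarrow>
      \<rho> (\<phi> (x + y) + \<phi> (x - y) - scaleY 2 (\<phi> x) - scaleY 2 (\<phi> y)) \<le> \<alpha> x y"
  shows "quadratic_on scaleY E \<phi>"
proof -
  interpret X: vector_space scaleX by (rule X)
  interpret convex_modular scaleY \<rho> by (rule modular)
  note add = null_seq_add[OF delta2] and diff = null_seq_diff[OF delta2]
  define D where "D x y = \<phi> (x + y) + \<phi> (x - y) - (\<phi> x + \<phi> x) - (\<phi> y + \<phi> y)" for x y
  define m where "m n z = scaleX (of_nat n) z" for n z
  have m_in: "m n z \<in> E" if "z \<in> E" for n z
    using E_scale that by (simp add: m_def)
  have D_in: "D x y \<in> modular_space scaleY \<rho>" if "x \<in> E" "y \<in> E" for x y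
    using that
    by (simp add: D_def modular_space_add modular_space_diff \<phi>_range E_add E_diff)
  have D_le: "\<rho> (D x y) \<le> \<alpha> x y" if "x \<in> E" "y \<in> E" for x y
    using \<phi>_approx[OF that] by (simp add: D_def scale_two)
  have null1: "null_seq (\<lambda>n. D x (m n x))" if "x \<in> E" for x
    by (rule null_seqI[where a = "\<lambda>n. \<alpha> x (m n x)"])
      (use that \<alpha>_lim1[OF that] in \<open>auto simp: D_in D_le m_in m_def[symmetric]\<close>)
  have null2: "null_seq (\<lambda>n. D (m n x) (m n y))" if "x \<in> E" "y \<in> E" for x y
    by (rule null_seqI[where a = "\<lambda>n. \<alpha> (m n x) (m n y)"])
      (use that \<alpha>_lim2[OF that] in \<open>auto simp: D_in D_le m_in m_def[symmetric]\<close>)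
  have zero: "0 \<in> E"
    using E_nonempty E_diff by fastforce
  have m_zero: "m n 0 = 0" for n
    by (simp add: m_def)
  \<comment> \<open>At the origin the second limit concerns a constant sequence, and
    \<open>D 0 0\<close> is minus twice \<open>\<phi> 0\<close>.\<close>
  have "D 0 0 = 0"
    using null2[OF zero zero] by (simp add: m_zero null_seq_const)
  then have \<phi>_zero: "\<phi> 0 = 0"
    using double_eq_zero[of "\<phi> 0"] by (metis D_def add_0 diff_self neg_equal_0_iff_equal diff_0)
  define T where
    "T z n = \<phi> (m (n + 2) z) + \<phi> (m n z) - (\<phi> (m (n + 1) z) + \<phi> (m (n + 1) z)) - (\<phi> z + \<phi> z)"
    for z n
  have T: "null_seq (T z)" if z: "z \<in> E" for z
  proof -
    \<comment> \<open>The difference \<open>z - m (n + 1) z\<close> yields \<phi> at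
      \<open>- m n z\<close>, whereas \<open>T\<close> needs it at \<open>m n z\<close>. As \<phi>
      vanishes at 0, \<open>D 0 w\<close> is \<open>\<phi> (- w) - \<phi> w\<close>, so subtracting
      it corrects the sign. Writing 0 as \<open>m n 0\<close> makes \<open>null2\<close>
      applicable.\<close>
    have m_step: "z + m (n + 1) z = m (n + 2) z" "z - m (n + 1) z = - m n z" for n
      using X.scale_left_distrib[of 1 1 z] by (simp_all add: m_def algebra_simps)
    have "T z = (\<lambda>n. D z (m (n + 1) z) - D (m n 0) (m n z))"
      unfolding T_def D_def m_step m_zero by (simp add: \<phi>_zero fun_eq_iff)
    then show ?thesis
      using diff[OF null_seq_offset[OF null1[OF z], of 1] null2[OF zero z]] by simp
  qed
  show ?thesis
    unfolding quadratic_on_def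
  proof (intro ballI)
    fix x y assume x: "x \<in> E" and y: "y \<in> E"
    let ?S = "\<lambda>n. D (m n x) (m n y)"
    \<comment> \<open>\<open>D\<close> is additive in \<phi>, so the second difference
      \<open>?V\<close> of \<open>?S\<close> is the same combination of second differences of \<phi>
      along the multiples of \<open>x + y\<close>, \<open>x - y\<close>, \<open>x\<close> and
      \<open>y\<close>.\<close>
    let ?U = "\<lambda>n. T (x + y) n + T (x - y) n - (T x n + T x n) - (T y n + T y n)"
    let ?V = "\<lambda>n. ?S (n + 2) + ?S n - (?S (n + 1) + ?S (n + 1))"
    have S: "null_seq (\<lambda>n. ?S (n + k))" for k
      by (rule null_seq_offset[OF null2[OF x y]])
    have "null_seq ?V"
      using S[of 0] S[of 1] S[of 2] by (intro add diff) simp_all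
    moreover have "null_seq ?U"
      using x y by (intro add diff T E_add E_diff)
    ultimately have "null_seq (\<lambda>n. ?V n - ?U n)"
      by (rule diff)
    \<comment> \<open>All terms in \<open>n\<close> cancel; what remains are the constants
      \<open>\<phi> z + \<phi> z\<close> subtracted in each \<open>T z n\<close>.\<close>
    moreover have "?V n - ?U n = D x y + D x y" for n
      by (simp add: D_def T_def m_def X.scale_right_distrib X.scale_right_diff_distrib)
    ultimately have "D x y + D x y = 0"
      by (simp add: null_seq_const)
    then have "D x y = 0"
      by (rule double_eq_zero)
    then show "\<phi> (x + y) + \<phi> (x - y) = scaleY 2 (\<phi> x) + scaleY 2 (\<phi> y)"
      by (simp add: D_def scale_two algebra_simps)
  qed
qed

end
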